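(* Let $p,q\in\mathbb{N}$. The Hadamard map $H_{p,q}:\Delta^p\times\Delta^q\to\Delta^{pq}$, given at level $[m]$ by $(\alpha,\beta)\mapsto\alpha\boxtimes\beta$, induces a natural transformation $$\delta_{p,q}: P([p],[q];-)\longrightarrow \Delta(-,[pq])$$ of functors $\Delta^{\mathrm{op}}\to\mathbf{Set}$. Namely, the assignment whose component at $[r]$ sends the class in $P([p],[q];[r])$ of a triple $(\alpha:[m]\to[p],\ \beta:[m]\to[q],\ \gamma:[r]\to[m])$ to $$\delta_{p,q;[r]}[\alpha,\beta,\gamma] := (\alpha\boxtimes\beta)\circ\gamma\ \in\ \Delta([r],[pq])$$ is well defined and natural in $[r]$.
   Context: The simplex category $\Delta$ has objects the finite ordinals $[n]=\{0<1<\cdots<n\}$ for $n\in\mathbb{N}$ (including $n=0$) and morphisms the nondecreasing maps. $\Delta^n := \Delta(-,[n])$ denotes the representable simplicial set. The kernel $P:\Delta\times\Delta\times\Delta^{\mathrm{op}}\to\mathbf{Set}$ is the coend $$P([p],[q];[r]) := \int^{[m]\in\Delta} \Delta([m],[p])\times\Delta([m],[q])\times\Delta([r],[m]),$$ with action on morphisms by composition in the respective factors. Thus an element is an equivalence class $[\alpha,\beta,\gamma]$ of triples $(\alpha:[m]\to[p],\beta:[m]\to[q],\gamma:[r]\to[m])$ under the equivalence relation generated by $[\alpha\circ f,\beta\circ f,\gamma]\sim[\alpha,\beta,f\circ\gamma]$ for $f:[m']\to[m]$, $\gamma:[r]\to[m']$; and for $h:[r']\to[r]$, $P(\mathrm{id},\mathrm{id};h)$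 sends $[\alpha,\beta,\gamma]$ to $[\alpha,\beta,\gamma\circ h]$. The Hadamard product of $\alpha\in\Delta([m],[p])$ and $\beta\in\Delta([m],[q])$ is $\alpha\boxtimes\beta\in\Delta([m],[pq])$, $(\alpha\boxtimes\beta)(t) := \alpha(t)\cdot\beta(t)$ (multiplication of natural numbers) for $0\le t\le m$. *)

theory Defs
  imports Main "HOL-Library.FuncSet"
begin

text \<open>
  The object \<open>[n]\<close> of the simplex category is represented by the number \<open>n\<close>, with underlying
  set \<open>{..n}\<close>. Morphisms are extensional functions, so that equality of morphisms is equality in
  HOL; the composite of \<open>f : [l] \<rightarrow> [m]\<close> and \<open>g : [m] \<rightarrow> [n]\<close> is \<open>compose {..l} g f\<close>.
\<close>

definition simplex_hom :: "nat \<Rightarrow> nat \<Rightarrow> (nat \<Rightarrow> nat) set" where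
  "simplex_hom m n = {f \<in> {..m} \<rightarrow>\<^sub>E {..n}. mono_on {..m} f}"

definition simplex_id :: "nat \<Rightarrow> nat \<Rightarrow> nat" where
  "simplex_id n = (\<lambda>t\<in>{..n}. t)"

text \<open>
  Data of a functor \<open>\<Delta>\<^sup>o\<^sup>p \<rightarrow> Set\<close>: for \<open>f : [m] \<rightarrow> [n]\<close>, the map \<open>pull X m n f\<close> goes
  from \<open>cells X n\<close> to \<open>cells X m\<close>.
\<close>

record 'a sset =
  cells :: "nat \<Rightarrow> 'a set"
  pull :: "nat \<Rightarrow> nat \<Rightarrow> (nat \<Rightarrow> nat) \<Rightarrow> 'a \<Rightarrow> 'a"

definition simplicial_set :: "'a sset \<Rightarrow> bool" where
  "simplicial_set X \<longleftrightarrow>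
     (\<forall>m n. \<forall>f\<in>simplex_hom m n. pull X m n f \<in> cells X n \<rightarrow> cells X m) \<and>
     (\<forall>n. \<forall>x\<in>cells X n. pull X n n (simplex_id n) x = x) \<and>
     (\<forall>l m n. \<forall>f\<in>simplex_hom l m. \<forall>g\<in>simplex_hom m n. \<forall>x\<in>cells X n.
        pull X l n (compose {..l} g f) x = pull X l m f (pull X m n g x))"

definition natural_transformation ::
    "'a sset \<Rightarrow> 'b sset \<Rightarrow> (nat \<Rightarrow> 'a \<Rightarrow> 'b) \<Rightarrow> bool" where
  "natural_transformation X Y \<eta> \<longleftrightarrow>
     simplicial_set X \<and> simplicial_set Y \<and>
     (\<forall>n. \<eta> n \<in> cells X n \<rightarrow> cells Y n) \<and>
     (\<forall>m n. \<forall>f\<in>simplex_hom m n. \<forall>x\<in>cells X n.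
        \<eta> m (pull X m n f x) = pull Y m n f (\<eta> n x))"

definition std_simplex :: "nat \<Rightarrow> (nat \<Rightarrow> nat) sset" where
  "std_simplex n =
     \<lparr>cells = (\<lambda>m. simplex_hom m n), pull = (\<lambda>l m f \<alpha>. compose {..l} \<alpha> f)\<rparr>"

definition sset_prod :: "'a sset \<Rightarrow> 'b sset \<Rightarrow> ('a \<times> 'b) sset" where
  "sset_prod X Y =
     \<lparr>cells = (\<lambda>n. cells X n \<times> cells Y n),
      pull = (\<lambda>m n f. map_prod (pull X m n f) (pull Y m n f))\<rparr>"

definition hadamard :: "nat \<Rightarrow> (nat \<Rightarrow> nat) \<Rightarrow> (nat \<Rightarrow> nat) \<Rightarrow> nat \<Rightarrow> nat" where
  "hadamard m \<alpha> \<beta> = (\<lambda>t\<in>{..m}. \<alpha> t * \<beta> t)"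

definition hadamard_map :: "nat \<Rightarrow> (nat \<Rightarrow> nat) \<times> (nat \<Rightarrow> nat) \<Rightarrow> nat \<Rightarrow> nat" where
  "hadamard_map m = (\<lambda>(\<alpha>, \<beta>). hadamard m \<alpha> \<beta>)"

text \<open>
  The coend \<open>P([p],[q];[r])\<close> is the quotient of the disjoint union over \<open>m\<close> of the sets
  \<open>\<Delta>([m],[p]) \<times> \<Delta>([m],[q]) \<times> \<Delta>([r],[m])\<close> by the equivalence relation generated by
  \<open>(\<alpha> \<circ> f, \<beta> \<circ> f, \<gamma>) \<sim> (\<alpha>, \<beta>, f \<circ> \<gamma>)\<close>. The summand index \<open>m\<close> is the first component
  of a tuple.
\<close>

type_synonym kernel_tuple = "nat \<times> (nat \<Rightarrow> nat) \<times> (nat \<Rightarrow> nat) \<times> (nat \<Rightarrow> nat)"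

definition kernel_tuples :: "nat \<Rightarrow> nat \<Rightarrow> nat \<Rightarrow> kernel_tuple set" where
  "kernel_tuples p q r =
     {(m, \<alpha>, \<beta>, \<gamma>). \<alpha> \<in> simplex_hom m p \<and> \<beta> \<in> simplex_hom m q \<and> \<gamma> \<in> simplex_hom r m}"

inductive_set kernel_rel :: "nat \<Rightarrow> nat \<Rightarrow> nat \<Rightarrow> (kernel_tuple \<times> kernel_tuple) set"
  for p q r :: nat where
  glue: "\<lbrakk>f \<in> simplex_hom m' m; \<alpha> \<in> simplex_hom m p; \<beta> \<in> simplex_hom m q;
          \<gamma> \<in> simplex_hom r m'\<rbrakk> \<Longrightarrow>
    ((m', compose {..m'} \<alpha> f, compose {..m'} \<beta> f, \<gamma>), (m, \<alpha>, \<beta>, compose {..r} f \<gamma>))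
      \<in> kernel_rel p q r"
| refl: "t \<in> kernel_tuples p q r \<Longrightarrow> (t, t) \<in> kernel_rel p q r"
| sym: "(s, t) \<in> kernel_rel p q r \<Longrightarrow> (t, s) \<in> kernel_rel p q r"
| trans: "\<lbrakk>(s, t) \<in> kernel_rel p q r; (t, u) \<in> kernel_rel p q r\<rbrakk> \<Longrightarrow> (s, u) \<in> kernel_rel p q r"

definition kernel :: "nat \<Rightarrow> nat \<Rightarrow> nat \<Rightarrow> kernel_tuple set set" where
  "kernel p q r = kernel_tuples p q r // kernel_rel p q r"

definition kernel_class ::
    "nat \<Rightarrow> nat \<Rightarrow> nat \<Rightarrow> nat \<Rightarrow> (nat \<Rightarrow> nat) \<Rightarrow> (nat \<Rightarrow> nat) \<Rightarrow> (nat \<Rightarrow> nat) \<Rightarrow> kernel_tuple set" where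
  "kernel_class p q r m \<alpha> \<beta> \<gamma> = kernel_rel p q r `` {(m, \<alpha>, \<beta>, \<gamma>)}"

text \<open>
  \<open>kernel_map p' q' r' f g h\<close> is \<open>P(f, g; h) : P([p],[q];[r]) \<rightarrow> P([p'],[q'];[r'])\<close> for
  \<open>f : [p] \<rightarrow> [p']\<close>, \<open>g : [q] \<rightarrow> [q']\<close>, \<open>h : [r'] \<rightarrow> [r]\<close>. The union ranges over the
  representatives of the class \<open>c\<close>, all of which contribute the same class.
\<close>

definition kernel_map ::
    "nat \<Rightarrow> nat \<Rightarrow> nat \<Rightarrow> (nat \<Rightarrow> nat) \<Rightarrow> (nat \<Rightarrow> nat) \<Rightarrow> (nat \<Rightarrow> nat) \<Rightarrow>
     kernel_tuple set \<Rightarrow> kernel_tuple set" where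
  "kernel_map p' q' r' f g h c =
     (\<Union>(m, \<alpha>, \<beta>, \<gamma>)\<in>c.
        kernel_class p' q' r' m (compose {..m} f \<alpha>) (compose {..m} g \<beta>) (compose {..r'} \<gamma> h))"

definition kernel_sset :: "nat \<Rightarrow> nat \<Rightarrow> kernel_tuple set sset" where
  "kernel_sset p q =
     \<lparr>cells = kernel p q,
      pull = (\<lambda>r' r h. kernel_map p q r' (simplex_id p) (simplex_id q) h)\<rparr>"

definition delta_tuple :: "nat \<Rightarrow> kernel_tuple \<Rightarrow> nat \<Rightarrow> nat" where
  "delta_tuple r = (\<lambda>(m, \<alpha>, \<beta>, \<gamma>). compose {..r} (hadamard m \<alpha> \<beta>) \<gamma>)"

text \<open>
  The value on a class is the common value of \<open>delta_tuple\<close> on its representatives; it is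
  unspecified if \<open>delta_tuple\<close> is not constant on the class.
\<close>

definition delta :: "nat \<Rightarrow> kernel_tuple set \<Rightarrow> nat \<Rightarrow> nat" where
  "delta r c = the_elem (delta_tuple r ` c)"

end

theory Submission
  imports Defs
begin

text \<open>The Hadamard product is formed pointwise, so it commutes with precomposition: (\<alpha>
  o f) * (\<beta> o f) = (\<alpha> * \<beta>) o f (\<open>hadamard_compose\<close>). This is already
  the naturality of the Hadamard map. It also shows that both sides of a generating relation of the
  coend have the value (\<alpha> * \<beta>) o f o \<gamma> (\<open>delta_tuple_respects\<close>), so
  the assignment descends to classes (\<open>delta_kernel_class\<close>). A map h acts on a class
  only by \<gamma> \<mapsto> \<gamma> o h (\<open>kernel_map_id_class\<close>), hence naturality in
  [r] is associativity of composition. The remaining work is that the coend is a functor: pre- and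
  postcomposition respect the gluing relation (\<open>kernel_rel_map\<close>).\<close>

lemma simplex_homI:
  assumes "f \<in> extensional {..m}" and "\<And>t. t \<le> m \<Longrightarrow> f t \<le> n"
    and "\<And>s t. s \<le> t \<Longrightarrow> t \<le> m \<Longrightarrow> f s \<le> f t"
  shows "f \<in> simplex_hom m n"
  using assms by (auto simp: simplex_hom_def PiE_def mono_on_def)

lemma simplex_hom_extensional: "f \<in> simplex_hom m n \<Longrightarrow> f \<in> extensional {..m}"
  by (simp add: simplex_hom_def PiE_def)

lemma simplex_hom_le: "f \<in> simplex_hom m n \<Longrightarrow> t \<le> m \<Longrightarrow> f t \<le> n"
  by (auto simp: simplex_hom_def)

lemma simplex_hom_mono: "f \<in> simplex_hom m n \<Longrightarrow> s \<le> t \<Longrightarrow> t \<le> m \<Longrightarrow> f s \<le> f t"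
  by (auto simp: simplex_hom_def mono_on_def)

lemma simplex_id_in_hom: "simplex_id n \<in> simplex_hom n n"
  by (auto intro!: simplex_homI simp: simplex_id_def)

lemma simplex_compose_in_hom:
  assumes "f \<in> simplex_hom l m" and "g \<in> simplex_hom m n"
  shows "compose {..l} g f \<in> simplex_hom l n"
  using assms
  by (auto intro!: simplex_homI
      simp: compose_def simplex_hom_le simplex_hom_mono[OF assms(1)] simplex_hom_mono[OF assms(2)])

lemma simplex_compose_id:
  "f \<in> simplex_hom m n \<Longrightarrow> compose {..m} f (simplex_id m) = f"
  by (rule extensionalityI[of _ "{..m}"])
    (auto simp: simplex_id_def compose_def simplex_hom_extensional)

lemma simplex_id_compose:
  "f \<in> simplex_hom m n \<Longrightarrow> compose {..m} (simplex_id n) f = f"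
  by (rule extensionalityI[of _ "{..m}"])
    (auto simp: simplex_id_def compose_def simplex_hom_extensional simplex_hom_le)

text \<open>Only \<open>f\<close> needs a type: it lands in \<open>{..l}\<close>, where the
  restriction built into the inner composite has no effect.\<close>

lemma simplex_compose_assoc:
  "f \<in> simplex_hom k l \<Longrightarrow>
    compose {..k} (compose {..l} h g) f = compose {..k} h (compose {..k} g f)"
  by (auto simp: compose_def simplex_hom_le fun_eq_iff)

text \<open>Multiplication of natural numbers is monotone in both factors, which gives both the
  bound and the order preservation.\<close>

lemma hadamard_in_hom:
  assumes "\<alpha> \<in> simplex_hom m p" and "\<beta> \<in> simplex_hom m q"
  shows "hadamard m \<alpha> \<beta> \<in> simplex_hom m (p * q)"
  using assms
  by (auto intro!: simplex_homI mult_le_mono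
      simp: hadamard_def simplex_hom_le simplex_hom_mono[OF assms(1)] simplex_hom_mono[OF assms(2)])

text \<open>Both sides take the value \<alpha>(f t) * \<beta>(f t) at t in \<open>{..l}\<close>,
  because f t lies in \<open>{..m}\<close>; outside \<open>{..l}\<close> both are
  \<open>undefined\<close>.\<close>

lemma hadamard_compose:
  "f \<in> simplex_hom l m \<Longrightarrow>
    hadamard l (compose {..l} \<alpha> f) (compose {..l} \<beta> f) = compose {..l} (hadamard m \<alpha> \<beta>) f"
  by (auto simp: hadamard_def compose_def simplex_hom_le fun_eq_iff)

lemma simplicial_set_std_simplex: "simplicial_set (std_simplex n)"
  by (auto simp: simplicial_set_def std_simplex_def simplex_compose_in_hom simplex_compose_id
      simplex_compose_assoc)

lemma simplicial_set_sset_prod: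
  "simplicial_set X \<Longrightarrow> simplicial_set Y \<Longrightarrow> simplicial_set (sset_prod X Y)"
  unfolding simplicial_set_def sset_prod_def by (fastforce simp: Pi_iff)

lemma natural_transformation_hadamard_map:
  "natural_transformation (sset_prod (std_simplex p) (std_simplex q))
     (std_simplex (p * q)) hadamard_map"
  unfolding natural_transformation_def
  by (auto simp: simplicial_set_sset_prod simplicial_set_std_simplex)
    (auto simp: sset_prod_def std_simplex_def hadamard_map_def hadamard_in_hom hadamard_compose)

lemma kernel_tuplesI:
  "\<alpha> \<in> simplex_hom m p \<Longrightarrow> \<beta> \<in> simplex_hom m q \<Longrightarrow> \<gamma> \<in> simplex_hom r m \<Longrightarrow>
    (m, \<alpha>, \<beta>, \<gamma>) \<in> kernel_tuples p q r"
  by (simp add: kernel_tuples_def)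

lemma kernel_rel_in_tuples:
  "(s, t) \<in> kernel_rel p q r \<Longrightarrow> s \<in> kernel_tuples p q r \<and> t \<in> kernel_tuples p q r"
  by (induction rule: kernel_rel.induct) (auto simp: kernel_tuples_def simplex_compose_in_hom)

lemma equiv_kernel_rel: "equiv (kernel_tuples p q r) (kernel_rel p q r)"
proof (rule equivI)
  show "kernel_rel p q r \<subseteq> kernel_tuples p q r \<times> kernel_tuples p q r"
    using kernel_rel_in_tuples by fast
  show "refl_on (kernel_tuples p q r) (kernel_rel p q r)"
    by (intro refl_onI kernel_rel.refl)
  show "sym (kernel_rel p q r)"
    by (rule symI) (rule kernel_rel.sym)
  show "trans (kernel_rel p q r)"
    by (rule transI) (rule kernel_rel.trans)
qed

lemma kernel_class_in_kernel:
  "\<alpha> \<in> simplex_hom m p \<Longrightarrow> \<beta> \<in> simplex_hom m q \<Longrightarrow> \<gamma> \<in> simplex_hom r m \<Longrightarrow>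
    kernel_class p q r m \<alpha> \<beta> \<gamma> \<in> kernel p q r"
  unfolding kernel_class_def kernel_def by (intro quotientI kernel_tuplesI)

text \<open>Reduces the functor laws and naturality to computations on representatives.\<close>

lemma kernel_cases:
  assumes "c \<in> kernel p q r"
  obtains m \<alpha> \<beta> \<gamma> where "\<alpha> \<in> simplex_hom m p" "\<beta> \<in> simplex_hom m q" "\<gamma> \<in> simplex_hom r m"
    "c = kernel_class p q r m \<alpha> \<beta> \<gamma>"
  using assms unfolding kernel_def kernel_class_def
  by (elim quotientE) (auto simp: kernel_tuples_def)

text \<open>Makes the action of the kernel on morphisms well defined. The maps \<open>f\<close>,
  \<open>g\<close>, \<open>h\<close> act at the outer ends of a triple, whereas gluing moves a map
  across the middle object, so associativity separates the two.\<close>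

lemma kernel_rel_map:
  assumes "(s, t) \<in> kernel_rel p q r"
    and f: "f \<in> simplex_hom p p'" and g: "g \<in> simplex_hom q q'" and h: "h \<in> simplex_hom r' r"
  defines "F \<equiv> \<lambda>(m, \<alpha>, \<beta>, \<gamma>). (m, compose {..m} f \<alpha>, compose {..m} g \<beta>, compose {..r'} \<gamma> h)"
  shows "(F s, F t) \<in> kernel_rel p' q' r'"
  using assms(1)
proof (induction rule: kernel_rel.induct)
  case (glue k m' m \<alpha> \<beta> \<gamma>)
  \<comment> \<open>The same map \<open>k\<close> glues the transported triples; reassociating turns
    this pair into the images under \<open>F\<close>.\<close>
  have "((m', compose {..m'} (compose {..m} f \<alpha>) k, compose {..m'} (compose {..m} g \<beta>) k,
           compose {..r'} \<gamma> h),
         (m, compose {..m} f \<alpha>, compose {..m} g \<beta>, compose {..r'} k (compose {..r'} \<gamma> h)))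
        \<in> kernel_rel p' q' r'"
    using glue f g h by (intro kernel_rel.glue simplex_compose_in_hom)
  then show ?case
    using glue h by (simp add: F_def simplex_compose_assoc)
next
  case (refl t)
  then show ?case
    using f g h
    by (auto simp: F_def kernel_tuples_def simplex_compose_in_hom intro!: kernel_rel.refl)
next
  case (sym s t)
  show ?case
    by (rule kernel_rel.sym[OF sym.IH])
next
  case (trans s t u)
  show ?case
    by (rule kernel_rel.trans[OF trans.IH])
qed

text \<open>All representatives contribute the same class, so the union defining
  \<open>kernel_map\<close> collapses to the contribution of any one of them.\<close>

lemma kernel_map_class:
  assumes f: "f \<in> simplex_hom p p'" and g: "g \<in> simplex_hom q q'" and h: "h \<in> simplex_hom r' r"
    and "\<alpha> \<in> simplex_hom m p" and "\<beta> \<in> simplex_hom m q" and "\<gamma> \<in> simplex_hom r m"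
  shows "kernel_map p' q' r' f g h (kernel_class p q r m \<alpha> \<beta> \<gamma>) =
    kernel_class p' q' r' m (compose {..m} f \<alpha>) (compose {..m} g \<beta>) (compose {..r'} \<gamma> h)"
proof -
  let ?F = "\<lambda>(m, \<alpha>, \<beta>, \<gamma>).
    kernel_class p' q' r' m (compose {..m} f \<alpha>) (compose {..m} g \<beta>) (compose {..r'} \<gamma> h)"
  have "?F respects kernel_rel p q r"
    using kernel_rel_map[OF _ f g h]
    by (fastforce simp: congruent_def kernel_class_def intro!: equiv_class_eq[OF equiv_kernel_rel])
  then have "(\<Union>t\<in>kernel_rel p q r `` {(m, \<alpha>, \<beta>, \<gamma>)}. ?F t) = ?F (m, \<alpha>, \<beta>, \<gamma>)"
    using assms by (intro UN_equiv_class[OF equiv_kernel_rel] kernel_tuplesI)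
  then show ?thesis
    by (simp add: kernel_map_def kernel_class_def[of p q r])
qed

lemma kernel_map_id_class:
  assumes "h \<in> simplex_hom r' r"
    and "\<alpha> \<in> simplex_hom m p" and "\<beta> \<in> simplex_hom m q" and "\<gamma> \<in> simplex_hom r m"
  shows "kernel_map p q r' (simplex_id p) (simplex_id q) h (kernel_class p q r m \<alpha> \<beta> \<gamma>) =
    kernel_class p q r' m \<alpha> \<beta> (compose {..r'} \<gamma> h)"
  using assms by (simp add: kernel_map_class simplex_id_in_hom simplex_id_compose)

lemma simplicial_set_kernel_sset: "simplicial_set (kernel_sset p q)"
  unfolding simplicial_set_def kernel_sset_def
  by (auto elim!: kernel_cases simp: kernel_map_id_class simplex_id_in_hom simplex_compose_id
      simplex_compose_in_hom simplex_compose_assoc kernel_class_in_kernel)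

text \<open>Having equal values is itself an equivalence relation, so only the generating pairs
  matter.\<close>

lemma delta_tuple_respects: "delta_tuple r respects kernel_rel p q r"
proof (rule congruentI)
  fix s t
  assume "(s, t) \<in> kernel_rel p q r"
  then show "delta_tuple r s = delta_tuple r t"
    by (induction rule: kernel_rel.induct)
      (auto simp: delta_tuple_def hadamard_compose simplex_compose_assoc)
qed

lemma delta_kernel_class:
  assumes "\<alpha> \<in> simplex_hom m p" and "\<beta> \<in> simplex_hom m q" and "\<gamma> \<in> simplex_hom r m"
  shows "delta r (kernel_class p q r m \<alpha> \<beta> \<gamma>) = compose {..r} (hadamard m \<alpha> \<beta>) \<gamma>"
proof -
  let ?t = "(m, \<alpha>, \<beta>, \<gamma>)"
  \<comment> \<open>Ensures that the class is nonempty, so that the image is a singleton and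
    \<open>the_elem\<close> returns its element.\<close>
  have "(?t, ?t) \<in> kernel_rel p q r"
    using assms by (intro kernel_rel.refl kernel_tuplesI)
  moreover have "delta_tuple r s = delta_tuple r ?t" if "(?t, s) \<in> kernel_rel p q r" for s
    using congruentD[OF delta_tuple_respects that] by simp
  ultimately have "delta_tuple r ` (kernel_rel p q r `` {?t}) = {delta_tuple r ?t}"
    by blast
  then show ?thesis
    by (simp add: delta_def kernel_class_def delta_tuple_def)
qed

lemma natural_transformation_delta:
  "natural_transformation (kernel_sset p q) (std_simplex (p * q)) delta"
  unfolding natural_transformation_def
  by (auto simp: simplicial_set_kernel_sset simplicial_set_std_simplex)
    (auto elim!: kernel_cases simp: kernel_sset_def std_simplex_def delta_kernel_class
      hadamard_in_hom kernel_map_id_class simplex_compose_in_hom simplex_compose_assoc)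

theorem proposition2:
  fixes p q :: nat
  shows "natural_transformation (sset_prod (std_simplex p) (std_simplex q))
           (std_simplex (p * q)) hadamard_map
       \<and> (\<forall>r. delta_tuple r respects kernel_rel p q r)
       \<and> (\<forall>r m. \<forall>\<alpha>\<in>simplex_hom m p. \<forall>\<beta>\<in>simplex_hom m q. \<forall>\<gamma>\<in>simplex_hom r m.
            delta r (kernel_class p q r m \<alpha> \<beta> \<gamma>) = compose {..r} (hadamard m \<alpha> \<beta>) \<gamma>)
       \<and> natural_transformation (kernel_sset p q) (std_simplex (p * q)) delta"
  by (simp add: natural_transformation_hadamard_map delta_tuple_respects delta_kernel_class
      natural_transformation_delta)

end
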